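(* Suppose $\mathrm{MA}_{\omega_1}$. Then there exists $F:\omega_1\times\omega\to\omega_1$ which is universal, i.e., for every $f:\omega_1\times\omega\to\omega_1$ there exist $g:\omega_1\to\omega_1$ and $h:\omega\to\omega$ such that $$f(\alpha,n)=F(g(\alpha),h(n))\quad\text{for every }\alpha<\omega_1\text{ and }n<\omega.$$
   Context: $\mathrm{MA}_{\omega_1}$ is Martin's Axiom for $\aleph_1$ many dense sets in ccc partial orders. *)

theory Defs
  imports Main "HOL-Library.Countable_Set"
begin

unbundle cardinal_syntax

typedef omega1 = "Field (cardSuc natLeq)"
  using Field_cardSuc_not_empty[OF natLeq_Card_order] by blast

text \<open>
  A partial order is given by its carrier \<open>P\<close> and its order relation \<open>r\<close>; a pair
  \<open>(p, q) \<in> r\<close> reads \<open>p \<le> q\<close>, that is, \<open>p\<close> is the stronger condition.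
\<close>

definition compat :: "'p set \<Rightarrow> 'p rel \<Rightarrow> 'p \<Rightarrow> 'p \<Rightarrow> bool" where
  "compat P r p q \<longleftrightarrow> (\<exists>s\<in>P. (s, p) \<in> r \<and> (s, q) \<in> r)"

definition antichain :: "'p set \<Rightarrow> 'p rel \<Rightarrow> 'p set \<Rightarrow> bool" where
  "antichain P r A \<longleftrightarrow> A \<subseteq> P \<and> pairwise (\<lambda>p q. \<not> compat P r p q) A"

definition ccc :: "'p set \<Rightarrow> 'p rel \<Rightarrow> bool" where
  "ccc P r \<longleftrightarrow> (\<forall>A. antichain P r A \<longrightarrow> countable A)"

definition dense_in :: "'p set \<Rightarrow> 'p rel \<Rightarrow> 'p set \<Rightarrow> bool" where
  "dense_in P r D \<longleftrightarrow> D \<subseteq> P \<and> (\<forall>p\<in>P. \<exists>d\<in>D. (d, p) \<in> r)"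

definition filter_in :: "'p set \<Rightarrow> 'p rel \<Rightarrow> 'p set \<Rightarrow> bool" where
  "filter_in P r G \<longleftrightarrow> G \<subseteq> P \<and> G \<noteq> {} \<and>
     (\<forall>p\<in>G. \<forall>q\<in>P. (p, q) \<in> r \<longrightarrow> q \<in> G) \<and>
     (\<forall>p\<in>G. \<forall>q\<in>G. \<exists>s\<in>G. (s, p) \<in> r \<and> (s, q) \<in> r)"

text \<open>
  HOL cannot quantify over all types inside a formula, so Martin's Axiom is stated for the
  partial orders whose carrier is a set of elements of a given type \<open>'p\<close>. This is the full
  axiom cut down to the partial orders that fit into \<open>'p\<close>, hence a consequence of it for
  every \<open>'p\<close>. For countable \<open>'p\<close> it is only the
  weaker axiom for countable partial orders (and provable outright for finite \<open>'p\<close>), so a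
  theorem using it should require \<open>'p\<close> to have at least \<open>\<aleph>\<^sub>1\<close> elements.
\<close>

definition MA_omega1 :: "'p itself \<Rightarrow> bool" where
  "MA_omega1 _ \<longleftrightarrow>
     (\<forall>(P :: 'p set) r \<D>.
        P \<noteq> {} \<and> partial_order_on P r \<and> ccc P r \<and>
        |\<D>| \<le>o |UNIV :: omega1 set| \<and> (\<forall>D\<in>\<D>. dense_in P r D)
        \<longrightarrow> (\<exists>G. filter_in P r G \<and> (\<forall>D\<in>\<D>. G \<inter> D \<noteq> {})))"

end

theory Submission
  imports Defs "HOL-Library.Countable_Set_Type"
begin

text \<open>
  Every row of \<open>f\<close> has countable range, hence factors through one of \<open>\<aleph>\<^sub>1\<close> fixed enumerations
  \<open>e \<delta>\<close> of countable sets; recording \<open>\<delta>\<close> in \<open>g \<alpha>\<close> reduces the problem to functions with values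
  in \<open>\<omega>\<close>. For these, take an independent family of \<open>\<aleph>\<^sub>1\<close> reals and let \<open>U \<alpha> k\<close> be the \<open>\<alpha>\<close>-th real
  altered on a finite set coded by \<open>k\<close>. Finite approximations to an injective \<open>h\<close> and to \<open>k\<close> with
  \<open>U \<alpha> (k \<alpha>) (h n) = f \<alpha> n\<close> can be extended in \<open>n\<close> by independence and in \<open>\<alpha>\<close> by the finite
  alterations. As each row chooses among only countably many \<open>k\<close>, two of any uncountably many
  conditions have the same \<open>h\<close> and compatible \<open>k\<close>, so the partial order is ccc.
\<close>

section \<open>The cardinal \<open>\<aleph>\<^sub>1\<close>\<close>

lemma card_of_omega1: "|UNIV :: omega1 set| =o cardSuc natLeq"
proof -
  have "bij_betw Rep_omega1 UNIV (Field (cardSuc natLeq))"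
    by (metis (full_types) type_definition.Rep_range type_definition_omega1
        Rep_omega1_inject bij_betw_def inj_onI)
  hence "|UNIV :: omega1 set| =o |Field (cardSuc natLeq)|"
    by (rule card_of_ordIsoI)
  thus ?thesis
    using card_of_Field_ordIso[OF cardSuc_Card_order[OF natLeq_Card_order]]
    by (rule ordIso_transitive)
qed

lemma countable_iff_ordLess_omega1: "countable A \<longleftrightarrow> |A| <o |UNIV :: omega1 set|"
proof -
  have "|A| <o |UNIV :: omega1 set| \<longleftrightarrow> |A| <o cardSuc natLeq"
    by (meson card_of_omega1 ordIso_symmetric ordLess_ordIso_trans)
  also have "\<dots> \<longleftrightarrow> |A| \<le>o natLeq"
    by (rule cardSuc_ordLeq_ordLess[OF natLeq_Card_order card_of_Card_order])
  finally show ?thesis by (simp add: countable_card_le_natLeq)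
qed

lemma uncountable_omega1: "uncountable (UNIV :: omega1 set)"
  by (simp add: countable_iff_ordLess_omega1 ordLess_irreflexive)

lemma infinite_omega1: "infinite (UNIV :: omega1 set)"
  using uncountable_omega1 countable_finite by blast

lemma countable_ordLeq_omega1: "countable A \<Longrightarrow> |A| \<le>o |UNIV :: omega1 set|"
  using countable_iff_ordLess_omega1 ordLess_imp_ordLeq by blast

text \<open>By Cantor the reals exceed \<open>natLeq\<close>, hence reach its cardinal successor.
  This supplies the distinct sets \<open>X \<alpha>\<close> behind the independent family.\<close>

lemma omega1_ordLeq_reals: "|UNIV :: omega1 set| \<le>o |UNIV :: nat set set|"
proof -
  have "natLeq =o |UNIV :: nat set|"
    using card_of_nat ordIso_symmetric by blast
  moreover have "|UNIV :: nat set| <o |UNIV :: nat set set|"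
    using card_of_Pow[of "UNIV :: nat set"] by simp
  ultimately have "natLeq <o |UNIV :: nat set set|"
    by (rule ordIso_ordLess_trans)
  hence "cardSuc natLeq \<le>o |UNIV :: nat set set|"
    by (intro cardSuc_least natLeq_Card_order card_of_Card_order)
  with card_of_omega1 show ?thesis by (rule ordIso_ordLeq_trans)
qed

lemma card_of_UNIV_list_infinite:
  assumes "infinite (UNIV :: 'a set)"
  shows "|UNIV :: 'a list set| \<le>o |UNIV :: 'a set|"
proof -
  have *: "|{xs :: 'a list. length xs = n}| \<le>o |UNIV :: 'a set|" for n
  proof (induction n)
    case 0
    show ?case by (simp add: card_of_singl_ordLeq)
  next
    case (Suc n)
    have "{xs :: 'a list. length xs = Suc n}
            \<subseteq> (\<lambda>(x, xs). x # xs) ` (UNIV \<times> {xs. length xs = n})"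
      by (force simp: length_Suc_conv)
    hence "|{xs :: 'a list. length xs = Suc n}| \<le>o |(UNIV :: 'a set) \<times> {xs :: 'a list. length xs = n}|"
      by (rule surj_imp_ordLeq)
    also have "|(UNIV :: 'a set) \<times> {xs :: 'a list. length xs = n}| \<le>o |UNIV :: 'a set|"
      using assms Suc by (intro card_of_Times_ordLeq_infinite_Field)
        (auto simp: card_of_card_order_on card_of_refl ordIso_imp_ordLeq Field_card_of)
    finally show ?case .
  qed
  have "|\<Union>n. {xs :: 'a list. length xs = n}| \<le>o |UNIV :: 'a set|"
    using assms * by (intro card_of_UNION_ordLeq_infinite)
      (auto simp: infinite_iff_card_of_nat)
  moreover have "(\<Union>n. {xs :: 'a list. length xs = n}) = UNIV" by auto
  ultimately show ?thesis by simp
qed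

text \<open>Reduces counting finite partial maps to counting association lists, both for the size of
  the partial order and for the countability of the possible \<open>h\<close> in its ccc
  proof.\<close>

lemma finite_maps_subset_map_of: "{g. finite (dom g)} \<subseteq> range map_of"
proof
  fix g :: "'a \<rightharpoonup> 'b" assume "g \<in> {g. finite (dom g)}"
  hence "finite (dom g)" by simp
  from finite_list[OF this] obtain xs where xs: "set xs = dom g" ..
  have "g = map_of (map (\<lambda>x. (x, the (g x))) xs)"
    unfolding map_of_map_restrict xs by (rule ext) (simp add: restrict_map_def domIff)
  thus "g \<in> range map_of" by blast
qed

lemma card_of_finite_maps:
  assumes "infinite (UNIV :: 'a set)" "|UNIV :: 'b set| \<le>o |UNIV :: 'a set|"
  shows "|{g :: 'a \<rightharpoonup> 'b. finite (dom g)}| \<le>o |UNIV :: 'a set|"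
proof -
  have "|{g :: 'a \<rightharpoonup> 'b. finite (dom g)}| \<le>o |UNIV :: ('a \<times> 'b) list set|"
    by (rule surj_imp_ordLeq[OF finite_maps_subset_map_of])
  also have "|UNIV :: ('a \<times> 'b) list set| \<le>o |UNIV :: ('a \<times> 'b) set|"
    using assms by (intro card_of_UNIV_list_infinite) (simp add: finite_prod)
  also have "|UNIV :: ('a \<times> 'b) set| \<le>o |UNIV :: 'a set|"
    using assms card_of_Times_ordLeq_infinite_Field[of "|UNIV :: 'a set|" "UNIV :: 'a set" "UNIV :: 'b set"]
    by (simp add: card_of_card_order_on card_of_refl ordIso_imp_ordLeq Field_card_of)
  finally show ?thesis .
qed

text \<open>In the order type of \<open>\<omega>\<^sub>1\<close> proper initial segments are countable, and a countable
  union of them is not everything, so countable sets are bounded.\<close>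

lemma omega1_enumerations:
  "\<exists>e :: omega1 \<Rightarrow> nat \<Rightarrow> omega1. \<forall>A. countable A \<longrightarrow> (\<exists>\<delta>. A \<subseteq> range (e \<delta>))"
proof -
  define W where "W = |UNIV :: omega1 set|"
  \<comment> \<open>The closed segment is nonempty, so \<open>from_nat_into\<close> enumerates
    exactly it.\<close>
  define I where "I \<delta> = insert \<delta> (underS W \<delta>)" for \<delta>
  have cW: "Card_order W" and fW: "Field W = UNIV"
    by (simp_all add: W_def card_of_card_order_on Field_card_of)
  have cI: "countable (I \<delta>)" for \<delta>
  proof -
    have "countable (underS W \<delta>)"
      using card_of_underS[OF cW, of \<delta>] fW by (simp add: countable_iff_ordLess_omega1 W_def)
    thus ?thesis by (simp add: I_def)
  qed
  have wo: "Well_order W" by (simp add: W_def card_of_Well_order)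
  have "\<exists>\<delta>. A \<subseteq> I \<delta>" if A: "countable A" for A
  proof (rule ccontr)
    assume neg: "\<nexists>\<delta>. A \<subseteq> I \<delta>"
    have "UNIV \<subseteq> (\<Union>a\<in>A. I a)"
    proof
      \<comment> \<open>By totality of \<open>W\<close>, an \<open>a\<close> outside the closed
        segment below \<delta> lies above \<delta>; so the segments below the members of an
        unbounded \<open>A\<close> cover everything.\<close>
      fix \<delta>
      obtain a where "a \<in> A" "a \<notin> I \<delta>" using neg by blast
      moreover from this have "\<delta> \<in> I a"
        using wo fW by (auto simp: I_def underS_def well_order_on_def linear_order_on_def total_on_def)
      ultimately show "\<delta> \<in> (\<Union>a\<in>A. I a)" by blast
    qed
    moreover have "countable (\<Union>a\<in>A. I a)" using A cI by simp
    ultimately show False using uncountable_omega1 countable_subset by blast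
  qed
  moreover have "range (from_nat_into (I \<delta>)) = I \<delta>" for \<delta>
    using cI by (intro range_from_nat_into) (auto simp: I_def)
  ultimately show ?thesis by (intro exI[of _ "\<lambda>\<delta>. from_nat_into (I \<delta>)"]) simp
qed

section \<open>Transferring Martin's Axiom to other carriers\<close>

text \<open>The axiom speaks only of carriers inside \<open>'p\<close>. An injection copies order,
  antichains and dense sets there, and the filter pulls back. Only the carrier \<open>P\<close> has
  to be small: the type of pairs of partial maps used later has many more elements than
  \<open>omega1\<close>.\<close>

lemma MA_omega1D:
  fixes P :: "'c set"
  assumes MA: "MA_omega1 TYPE('p)"
    and card: "|P| \<le>o |UNIV :: 'p set|"
    and P: "P \<noteq> {}" "partial_order_on P r" "ccc P r"
    and \<D>: "|\<D>| \<le>o |UNIV :: omega1 set|" "\<And>D. D \<in> \<D> \<Longrightarrow> dense_in P r D"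
  obtains G where "filter_in P r G" "\<And>D. D \<in> \<D> \<Longrightarrow> G \<inter> D \<noteq> {}"
proof -
  obtain \<iota> :: "'c \<Rightarrow> 'p" where inj: "inj_on \<iota> P"
    using card card_of_ordLeq[of P "UNIV :: 'p set"] by blast
  define r' where "r' = map_prod \<iota> \<iota> ` r"
  have rP: "r \<subseteq> P \<times> P" and refl: "\<And>p. p \<in> P \<Longrightarrow> (p, p) \<in> r"
    and tr: "trans r" and as: "antisym r"
    using P(2) by (auto simp: partial_order_on_def preorder_on_def refl_on_def)
  have r': "(\<iota> p, \<iota> q) \<in> r' \<longleftrightarrow> (p, q) \<in> r" if "p \<in> P" "q \<in> P" for p q
  proof
    assume "(\<iota> p, \<iota> q) \<in> r'"
    then obtain a b where ab: "(a, b) \<in> r" "\<iota> p = \<iota> a" "\<iota> q = \<iota> b" by (auto simp: r'_def)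
    hence "a \<in> P" "b \<in> P" using rP by blast+
    with ab that inj have "p = a" "q = b" by (auto dest: inj_onD)
    with ab show "(p, q) \<in> r" by simp
  qed (force simp: r'_def)
  have r'P: "r' \<subseteq> \<iota> ` P \<times> \<iota> ` P" using rP by (auto simp: r'_def)
  have "partial_order_on (\<iota> ` P) r'"
    unfolding partial_order_on_def preorder_on_def
  proof (intro conjI r'P)
    show "refl_on (\<iota> ` P) r'" using refl r' by (auto simp: refl_on_def)
    show "trans r'"
    proof (rule transI)
      fix x y z assume xy: "(x, y) \<in> r'" and yz: "(y, z) \<in> r'"
      then obtain a b c where "a \<in> P" "b \<in> P" "c \<in> P" "x = \<iota> a" "y = \<iota> b" "z = \<iota> c"
        using r'P by blast
      thus "(x, z) \<in> r'" using xy yz r' tr by (simp, blast dest: transD)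
    qed
    show "antisym r'"
    proof (rule antisymI)
      fix x y assume xy: "(x, y) \<in> r'" and yx: "(y, x) \<in> r'"
      then obtain a b where "a \<in> P" "b \<in> P" "x = \<iota> a" "y = \<iota> b" using r'P by blast
      thus "x = y" using xy yx r' as by (simp, blast dest: antisymD)
    qed
  qed
  moreover have "ccc (\<iota> ` P) r'"
    unfolding ccc_def
  proof (intro allI impI)
    fix A assume A: "antichain (\<iota> ` P) r' A"
    define B where "B = {p \<in> P. \<iota> p \<in> A}"
    have AB: "A = \<iota> ` B" using A by (auto simp: antichain_def B_def)
    have "antichain P r B"
      unfolding antichain_def pairwise_def
    proof (intro conjI ballI impI notI)
      show "B \<subseteq> P" by (auto simp: B_def)
      fix p q assume pq: "p \<in> B" "q \<in> B" "p \<noteq> q" and "compat P r p q"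
      then obtain s where s: "s \<in> P" "(s, p) \<in> r" "(s, q) \<in> r" by (auto simp: compat_def)
      have "p \<in> P" "q \<in> P" "\<iota> p \<noteq> \<iota> q"
        using pq inj by (auto simp: B_def inj_on_def)
      hence "compat (\<iota> ` P) r' (\<iota> p) (\<iota> q)" using s r' by (auto simp: compat_def)
      thus False
        using A pq \<open>\<iota> p \<noteq> \<iota> q\<close> by (auto simp: antichain_def pairwise_def AB)
    qed
    thus "countable A" using P(3) AB by (simp add: ccc_def)
  qed
  moreover have "|(`) \<iota> ` \<D>| \<le>o |UNIV :: omega1 set|"
    using card_of_image \<D>(1) ordLeq_transitive by blast
  moreover have "\<forall>D\<in>(`) \<iota> ` \<D>. dense_in (\<iota> ` P) r' D"
  proof
    fix D' assume "D' \<in> (`) \<iota> ` \<D>"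
    then obtain D where D: "D \<in> \<D>" "D' = \<iota> ` D" by blast
    have DP: "D \<subseteq> P" and dense: "\<forall>p\<in>P. \<exists>d\<in>D. (d, p) \<in> r"
      using \<D>(2)[OF D(1)] by (auto simp: dense_in_def)
    have "\<exists>d\<in>D. (\<iota> d, \<iota> p) \<in> r'" if "p \<in> P" for p
      using dense that DP r' by blast
    thus "dense_in (\<iota> ` P) r' D'"
      using DP unfolding D(2) dense_in_def by blast
  qed
  moreover have "\<iota> ` P \<noteq> {}" using P(1) by simp
  ultimately have "\<exists>G. filter_in (\<iota> ` P) r' G \<and> (\<forall>D\<in>(`) \<iota> ` \<D>. G \<inter> D \<noteq> {})"
    by (intro MA[unfolded MA_omega1_def, THEN spec, THEN spec, THEN spec, THEN mp] conjI)
  then obtain G' where G': "filter_in (\<iota> ` P) r' G'"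
    and meet: "\<And>D. D \<in> (`) \<iota> ` \<D> \<Longrightarrow> G' \<inter> D \<noteq> {}"
    by auto
  define G where "G = {p \<in> P. \<iota> p \<in> G'}"
  have G'G: "G' = \<iota> ` G" using G' by (auto simp: G_def filter_in_def)
  have GP: "G \<subseteq> P" by (auto simp: G_def)
  show ?thesis
  proof
    show "filter_in P r G"
      unfolding filter_in_def
    proof (intro conjI GP ballI impI)
      show "G \<noteq> {}" using G' by (auto simp: filter_in_def G'G)
      show "q \<in> G" if "p \<in> G" "q \<in> P" "(p, q) \<in> r" for p q
        using that G' r' by (auto simp: G_def filter_in_def)
      show "\<exists>s\<in>G. (s, p) \<in> r \<and> (s, q) \<in> r" if "p \<in> G" "q \<in> G" for p q
      proof -
        have "\<exists>s\<in>G'. (s, \<iota> p) \<in> r' \<and> (s, \<iota> q) \<in> r'"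
          using that G' by (auto simp: G'G filter_in_def)
        thus ?thesis using that GP r' by (auto simp: G'G subset_iff)
      qed
    qed
    show "G \<inter> D \<noteq> {}" if "D \<in> \<D>" for D
    proof -
      have "D \<subseteq> P" using \<D>(2)[OF that] by (simp add: dense_in_def)
      moreover have "G' \<inter> \<iota> ` D \<noteq> {}" using meet that by simp
      then obtain d where "d \<in> D" "\<iota> d \<in> G'" by blast
      ultimately show ?thesis by (auto simp: G_def)
    qed
  qed
qed

section \<open>The generic column map\<close>

text \<open>A replacement for the \<open>\<Delta>\<close>-system lemma: if some point lies in uncountably many of
  the domains, fix the value there and remove it; otherwise any map meets the domains of only
  countably many others.\<close>

lemma uncountable_finite_maps_agree:
  fixes A :: "('a \<rightharpoonup> 'b :: countable) set"
  assumes "uncountable A" "\<And>p. p \<in> A \<Longrightarrow> finite (dom p)"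
  shows "\<exists>p\<in>A. \<exists>q\<in>A. p \<noteq> q \<and> (\<forall>x \<in> dom p \<inter> dom q. p x = q x)"
proof -
  have fixed_size: "\<exists>p\<in>A. \<exists>q\<in>A. p \<noteq> q \<and> (\<forall>x \<in> dom p \<inter> dom q. p x = q x)"
    if "uncountable A" "\<And>p. p \<in> A \<Longrightarrow> finite (dom p) \<and> card (dom p) = n"
    for n and A :: "('a \<rightharpoonup> 'b) set"
    using that
  proof (induction n arbitrary: A)
    case 0
    hence "A \<subseteq> {Map.empty}" by (auto simp: card_eq_0_iff)
    hence "countable A" by (rule countable_subset) simp
    thus ?case using 0 by blast
  next
    case (Suc n)
    show ?case
    proof (cases "\<exists>x. uncountable {p \<in> A. x \<in> dom p}")
      case True
      then obtain x where x: "uncountable {p \<in> A. x \<in> dom p}" by blast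
      \<comment> \<open>Values come from a countable type, so uncountably many maps share one value
        \<open>v\<close> at \<open>x\<close>. Erasing that entry is then reversible and lowers the
        domain size by one.\<close>
      have "{p \<in> A. x \<in> dom p} = (\<Union>v. {p \<in> A. p x = Some v})" by auto
      with x have "\<not> (\<forall>v. countable {p \<in> A. p x = Some v})"
        by (auto intro: countable_UN)
      then obtain v where v: "uncountable {p \<in> A. p x = Some v}" by blast
      define B where "B = {p \<in> A. p x = Some v}"
      have inj: "inj_on (\<lambda>p. p(x := None)) B"
        by (rule inj_on_inverseI[of _ "\<lambda>p. p(x := Some v)"]) (auto simp: B_def)
      have "uncountable ((\<lambda>p. p(x := None)) ` B)"
        using v inj B_def countable_image_inj_on by blast
      moreover have "finite (dom p') \<and> card (dom p') = n"
        if p': "p' \<in> (\<lambda>p. p(x := None)) ` B" for p'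
      proof -
        obtain p where p: "p \<in> B" "p' = p(x := None)" using p' by blast
        have "finite (dom p)" "card (dom p) = Suc n" "x \<in> dom p"
          using Suc.prems(2) p(1) by (auto simp: B_def)
        thus ?thesis by (simp add: p(2))
      qed
      ultimately obtain p' q' where pq: "p' \<in> (\<lambda>p. p(x := None)) ` B" "q' \<in> (\<lambda>p. p(x := None)) ` B"
        "p' \<noteq> q'" "\<forall>y \<in> dom p' \<inter> dom q'. p' y = q' y"
        using Suc.IH by meson
      \<comment> \<open>Putting \<open>x\<close> back is harmless, since both maps take the value
        \<open>v\<close> there.\<close>
      then obtain p q where "p \<in> B" "q \<in> B" "p' = p(x := None)" "q' = q(x := None)" by blast
      with pq have "p \<in> A" "q \<in> A" "p \<noteq> q" "\<forall>y \<in> dom p \<inter> dom q. p y = q y"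
        by (auto simp: B_def split: if_splits)
      thus ?thesis by blast
    next
      case False
      obtain p where p: "p \<in> A" using Suc.prems(1) by fastforce
      have "countable (insert p (\<Union>x\<in>dom p. {q \<in> A. x \<in> dom q}))"
        using False Suc.prems(2)[OF p] countable_finite by (auto intro!: countable_UN)
      with Suc.prems(1) have "uncountable (A - insert p (\<Union>x\<in>dom p. {q \<in> A. x \<in> dom q}))"
        by (rule uncountable_minus_countable)
      hence "A - insert p (\<Union>x\<in>dom p. {q \<in> A. x \<in> dom q}) \<noteq> {}"
        by (metis countable_empty)
      then obtain q where q: "q \<in> A" "q \<noteq> p" and disj: "\<And>x. x \<in> dom p \<Longrightarrow> x \<notin> dom q"
        by blast
      have "\<forall>x \<in> dom p \<inter> dom q. p x = q x" using disj by blast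
      with p q show ?thesis by metis
    qed
  qed
  \<comment> \<open>Finite domains have only countably many sizes, so one size occurs uncountably
    often.\<close>
  have union: "(\<Union>n. {p \<in> A. card (dom p) = n}) = A" by auto
  have "\<exists>n. uncountable {p \<in> A. card (dom p) = n}"
  proof (rule ccontr)
    assume "\<nexists>n. uncountable {p \<in> A. card (dom p) = n}"
    hence "countable (\<Union>n. {p \<in> A. card (dom p) = n})" by (intro countable_UN) auto
    thus False using assms(1) by (simp only: union)
  qed
  then obtain n where "uncountable {p \<in> A. card (dom p) = n}" ..
  from fixed_size[OF this] show ?thesis using assms(2) by blast
qed

text \<open>Distinct sets \<open>X \<alpha>\<close> of natural numbers are told apart by finite initial segments; a
  column codes a finite table prescribing values by such segments, together with a dummy entry
  that makes every pattern occur infinitely often.\<close>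

lemma independent_family_omega1:
  "\<exists>G :: omega1 \<Rightarrow> nat \<Rightarrow> nat. \<forall>S t. finite S \<longrightarrow> infinite {m. \<forall>\<alpha>\<in>S. G \<alpha> m = t \<alpha>}"
proof -
  obtain X :: "omega1 \<Rightarrow> nat set" where X: "inj X"
    using omega1_ordLeq_reals card_of_ordLeq[of "UNIV :: omega1 set" "UNIV :: nat set set"] by blast
  define seg where "seg \<alpha> N = map (\<lambda>i. i \<in> X \<alpha>) [0..<N]" for \<alpha> N
  define G where "G \<alpha> m = (case from_nat m :: nat \<times> nat \<times> (bool list \<times> nat) list of (N, _, T) \<Rightarrow>
      (case map_of T (seg \<alpha> N) of None \<Rightarrow> 0 | Some v \<Rightarrow> v))" for \<alpha> and m :: nat
  have "infinite {m. \<forall>\<alpha>\<in>S. G \<alpha> m = t \<alpha>}" if S: "finite S" for S and t :: "omega1 \<Rightarrow> nat"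
  proof -
    have "\<exists>i. (i \<in> X \<alpha>) \<noteq> (i \<in> X \<beta>)" if "\<alpha> \<noteq> \<beta>" for \<alpha> \<beta>
      using X that by (auto dest: injD)
    then obtain d where d: "\<And>\<alpha> \<beta>. \<alpha> \<noteq> \<beta> \<Longrightarrow> (d \<alpha> \<beta> \<in> X \<alpha>) \<noteq> (d \<alpha> \<beta> \<in> X \<beta>)" by metis
    \<comment> \<open>\<open>N\<close> lies beyond every point separating two members of
      \<open>S\<close>, so segments of length \<open>N\<close> tell them apart. For empty
      \<open>S\<close> the \<open>Max\<close> is unspecified, but then nothing has to be
      separated.\<close>
    define N where "N = Suc (Max (case_prod d ` (S \<times> S)))"
    have N: "d \<alpha> \<beta> < N" if "\<alpha> \<in> S" "\<beta> \<in> S" for \<alpha> \<beta>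
      unfolding N_def less_Suc_eq_le using S that by (intro Max_ge) auto
    have inj: "inj_on (\<lambda>\<alpha>. seg \<alpha> N) S"
    proof (rule inj_onI, rule ccontr)
      fix \<alpha> \<beta> assume *: "\<alpha> \<in> S" "\<beta> \<in> S" "seg \<alpha> N = seg \<beta> N" "\<alpha> \<noteq> \<beta>"
      hence "seg \<alpha> N ! d \<alpha> \<beta> = seg \<beta> N ! d \<alpha> \<beta>" by simp
      thus False using N[OF *(1,2)] d[OF *(4)] by (simp add: seg_def)
    qed
    obtain xs where xs: "set xs = S" "distinct xs" using finite_distinct_list[OF S] by blast
    define T where "T = map (\<lambda>\<alpha>. (seg \<alpha> N, t \<alpha>)) xs"
    have "map_of T (seg \<alpha> N) = Some (t \<alpha>)" if "\<alpha> \<in> S" for \<alpha>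
    proof (rule map_of_is_SomeI)
      show "distinct (map fst T)" using xs inj by (simp add: T_def distinct_map comp_def)
      show "(seg \<alpha> N, t \<alpha>) \<in> set T" using that xs by (auto simp: T_def)
    qed
    hence "range (\<lambda>j :: nat. to_nat (N, j, T)) \<subseteq> {m. \<forall>\<alpha>\<in>S. G \<alpha> m = t \<alpha>}"
      by (auto simp: G_def)
    moreover have "infinite (range (\<lambda>j :: nat. to_nat (N, j, T)))"
      by (rule range_inj_infinite) (simp add: inj_def)
    ultimately show ?thesis using infinite_super by blast
  qed
  thus ?thesis by blast
qed

section \<open>Independent reals with countably many finite alterations each\<close>

text \<open>The first clause will add columns to a condition, whatever alterations \<open>k\<close>
  its rows have chosen; infinitely many \<open>m\<close> are asked for so that used values can be
  avoided. The second will add rows.\<close>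

definition universal_seed :: "(omega1 \<Rightarrow> nat \<Rightarrow> nat \<Rightarrow> nat) \<Rightarrow> bool" where
  "universal_seed U \<longleftrightarrow>
     (\<forall>S t k. finite S \<longrightarrow> infinite {m. \<forall>\<alpha>\<in>S. U \<alpha> (k \<alpha>) m = t \<alpha>}) \<and>
     (\<forall>\<alpha> M q. finite M \<longrightarrow> (\<exists>k. \<forall>m\<in>M. U \<alpha> k m = q m))"

text \<open>The index \<open>k\<close> codes a finite table overriding \<open>G \<alpha>\<close>.
  Finitely many rows are thereby altered at only finitely many places, so infinite pattern sets stay
  infinite.\<close>

lemma universal_seed_exists: "\<exists>U. universal_seed U"
proof -
  obtain G :: "omega1 \<Rightarrow> nat \<Rightarrow> nat"
    where G: "\<And>S t. finite S \<Longrightarrow> infinite {m. \<forall>\<alpha>\<in>S. G \<alpha> m = t \<alpha>}"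
    using independent_family_omega1 by blast
  define tab where "tab k = map_of (from_nat k :: (nat \<times> nat) list)" for k
  define U where "U \<alpha> k m = (case tab k m of None \<Rightarrow> G \<alpha> m | Some v \<Rightarrow> v)" for \<alpha> k m
  have "infinite {m. \<forall>\<alpha>\<in>S. U \<alpha> (k \<alpha>) m = t \<alpha>}" if S: "finite S" for S t k
  proof -
    have "finite (\<Union>\<alpha>\<in>S. dom (tab (k \<alpha>)))"
      using S by (auto simp: tab_def finite_dom_map_of)
    hence "infinite ({m. \<forall>\<alpha>\<in>S. G \<alpha> m = t \<alpha>} - (\<Union>\<alpha>\<in>S. dom (tab (k \<alpha>))))"
      using G[OF S] by (rule Diff_infinite_finite)
    moreover have "{m. \<forall>\<alpha>\<in>S. G \<alpha> m = t \<alpha>} - (\<Union>\<alpha>\<in>S. dom (tab (k \<alpha>)))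
                     \<subseteq> {m. \<forall>\<alpha>\<in>S. U \<alpha> (k \<alpha>) m = t \<alpha>}"
      by (auto simp: U_def domIff)
    ultimately show ?thesis using infinite_super by blast
  qed
  moreover have "\<exists>k. \<forall>m\<in>M. U \<alpha> k m = q m" if M: "finite M" for \<alpha> M q
  proof -
    obtain xs where xs: "set xs = M" using finite_list[OF M] by blast
    have "tab (to_nat (map (\<lambda>m. (m, q m)) xs)) m = Some (q m)" if "m \<in> M" for m
      using that xs by (simp add: tab_def map_of_map_restrict)
    thus ?thesis by (intro exI[of _ "to_nat (map (\<lambda>m. (m, q m)) xs)"]) (simp add: U_def)
  qed
  ultimately show ?thesis unfolding universal_seed_def by blast
qed

section \<open>The partial order of finite approximations\<close>

text \<open>Injectivity of \<open>h\<close> keeps rows extendable: if two columns were sent to the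
  same \<open>m\<close>, a new row might have to take two different values at
  \<open>m\<close>.\<close>

definition cond :: "(omega1 \<Rightarrow> nat \<Rightarrow> nat \<Rightarrow> nat) \<Rightarrow> (omega1 \<Rightarrow> nat \<Rightarrow> nat)
    \<Rightarrow> ((nat \<rightharpoonup> nat) \<times> (omega1 \<rightharpoonup> nat)) set" where
  "cond U f = {(h, g). finite (dom h) \<and> inj_on h (dom h) \<and> finite (dom g) \<and>
     (\<forall>n m \<alpha> k. h n = Some m \<longrightarrow> g \<alpha> = Some k \<longrightarrow> U \<alpha> k m = f \<alpha> n)}"

definition cond_rel :: "(omega1 \<Rightarrow> nat \<Rightarrow> nat \<Rightarrow> nat) \<Rightarrow> (omega1 \<Rightarrow> nat \<Rightarrow> nat)
    \<Rightarrow> ((nat \<rightharpoonup> nat) \<times> (omega1 \<rightharpoonup> nat)) rel" where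
  "cond_rel U f = {((h', g'), (h, g)). (h', g') \<in> cond U f \<and> (h, g) \<in> cond U f
     \<and> h \<subseteq>\<^sub>m h' \<and> g \<subseteq>\<^sub>m g'}"

lemma partial_order_cond: "partial_order_on (cond U f) (cond_rel U f)"
  unfolding partial_order_on_def preorder_on_def
proof (intro conjI)
  show "cond_rel U f \<subseteq> cond U f \<times> cond U f" by (auto simp: cond_rel_def)
  show "refl_on (cond U f) (cond_rel U f)" by (auto simp: refl_on_def cond_rel_def)
  show "trans (cond_rel U f)"
    by (rule transI) (auto simp: cond_rel_def intro: map_le_trans)
  show "antisym (cond_rel U f)"
    by (rule antisymI) (auto simp: cond_rel_def intro: map_le_antisym)
qed

lemma ccc_cond: "ccc (cond U f) (cond_rel U f)"
  unfolding ccc_def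
proof (intro allI impI, rule ccontr)
  fix A assume A: "antichain (cond U f) (cond_rel U f) A" and unc: "uncountable A"
  have AC: "A \<subseteq> cond U f" using A by (simp add: antichain_def)
  have cnt: "countable {h :: nat \<rightharpoonup> nat. finite (dom h)}"
    by (rule countable_subset[OF finite_maps_subset_map_of]) simp
  have "A = (\<Union>h\<in>{h. finite (dom h)}. {p \<in> A. fst p = h})"
    using AC by (auto simp: cond_def)
  then obtain h where h: "uncountable {p \<in> A. fst p = h}"
    using unc cnt by (metis (no_types, lifting) countable_UN)
  define B where "B = snd ` {p \<in> A. fst p = h}"
  have "inj_on snd {p \<in> A. fst p = h}" by (auto simp: inj_on_def prod_eq_iff)
  hence "uncountable B" using h countable_image_inj_on unfolding B_def by blast
  moreover have B: "(h, g) \<in> A" if "g \<in> B" for g using that by (auto simp: B_def)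
  ultimately obtain g g' where g: "g \<in> B" "g' \<in> B" "g \<noteq> g'"
    "\<forall>\<alpha>\<in>dom g \<inter> dom g'. g \<alpha> = g' \<alpha>"
    using uncountable_finite_maps_agree[of B] AC by (fastforce simp: cond_def)
  have mem: "(h, g) \<in> cond U f" "(h, g') \<in> cond U f" using B g AC by auto
  \<comment> \<open>Each requirement involves a single row and the common \<open>h\<close>, so it is
    inherited from whichever of \<open>g\<close> and \<open>g'\<close> supplies that row.\<close>
  hence "(h, g ++ g') \<in> cond U f"
    by (auto simp: cond_def map_add_Some_iff)
  moreover have "g \<subseteq>\<^sub>m g ++ g'" "g' \<subseteq>\<^sub>m g ++ g'"
  proof -
    show "g' \<subseteq>\<^sub>m g ++ g'" by (rule map_le_map_add)
    show "g \<subseteq>\<^sub>m g ++ g'"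
      using g(4) unfolding map_le_def map_add_def by (metis IntI domIff option.case_eq_if option.collapse)
  qed
  ultimately have "compat (cond U f) (cond_rel U f) (h, g) (h, g')"
    using mem unfolding compat_def by (auto simp: cond_rel_def intro!: bexI[of _ "(h, g ++ g')"])
  thus False using A B g by (auto simp: antichain_def pairwise_def)
qed

text \<open>By independence infinitely many \<open>m\<close> give the right value in all of the
  finitely many rows of \<open>g\<close>; one of them lies outside \<open>ran h\<close>, which keeps
  \<open>h\<close> injective.\<close>

lemma dense_cond_column:
  assumes U: "universal_seed U"
  shows "dense_in (cond U f) (cond_rel U f) {p \<in> cond U f. n \<in> dom (fst p)}"
  unfolding dense_in_def
proof (intro conjI ballI)
  fix p assume p: "p \<in> cond U f"
  obtain h g where hg: "p = (h, g)" by fastforce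
  show "\<exists>d\<in>{p \<in> cond U f. n \<in> dom (fst p)}. (d, p) \<in> cond_rel U f"
  proof (cases "n \<in> dom h")
    case True
    thus ?thesis using p hg by (intro bexI[of _ p]) (auto simp: cond_rel_def)
  next
    case False
    have fin: "finite (dom h)" "finite (dom g)" using p hg by (auto simp: cond_def)
    have "infinite {m. \<forall>\<alpha>\<in>dom g. U \<alpha> (the (g \<alpha>)) m = f \<alpha> n}"
      using U fin(2) by (auto simp: universal_seed_def)
    moreover have "finite (ran h)" using fin(1) by (rule finite_ran)
    ultimately have "infinite ({m. \<forall>\<alpha>\<in>dom g. U \<alpha> (the (g \<alpha>)) m = f \<alpha> n} - ran h)"
      by (rule Diff_infinite_finite[rotated])
    hence "{m. \<forall>\<alpha>\<in>dom g. U \<alpha> (the (g \<alpha>)) m = f \<alpha> n} - ran h \<noteq> {}"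
      by (metis finite.emptyI)
    then obtain m where m: "m \<notin> ran h" "\<forall>\<alpha>\<in>dom g. U \<alpha> (the (g \<alpha>)) m = f \<alpha> n"
      by blast
    have "inj_on (h(n \<mapsto> m)) (dom (h(n \<mapsto> m)))"
      using p hg m(1) False by (auto simp: cond_def inj_on_def ran_def) 
    moreover have "U \<alpha> k m' = f \<alpha> n'" if "(h(n \<mapsto> m)) n' = Some m'" "g \<alpha> = Some k" for n' m' \<alpha> k
    proof (cases "n' = n")
      case True
      thus ?thesis using that m(2) by force
    next
      case False
      thus ?thesis using that p hg by (simp add: cond_def)
    qed
    ultimately have "(h(n \<mapsto> m), g) \<in> cond U f"
      using fin unfolding cond_def by (simp del: fun_upd_apply)
    moreover have "h \<subseteq>\<^sub>m h(n \<mapsto> m)" using False by (auto simp: map_le_def)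
    ultimately show ?thesis using p hg
      by (intro bexI[of _ "(h(n \<mapsto> m), g)"]) (auto simp: cond_rel_def)
  qed
qed auto

text \<open>Since \<open>h\<close> is injective, the demands on a new row form a consistent finite
  table of values on \<open>ran h\<close>, and some alteration realizes it.\<close>

lemma dense_cond_row:
  assumes U: "universal_seed U"
  shows "dense_in (cond U f) (cond_rel U f) {p \<in> cond U f. \<alpha> \<in> dom (snd p)}"
  unfolding dense_in_def
proof (intro conjI ballI)
  fix p assume p: "p \<in> cond U f"
  obtain h g where hg: "p = (h, g)" by fastforce
  show "\<exists>d\<in>{p \<in> cond U f. \<alpha> \<in> dom (snd p)}. (d, p) \<in> cond_rel U f"
  proof (cases "\<alpha> \<in> dom g")
    case True
    thus ?thesis using p hg by (intro bexI[of _ p]) (auto simp: cond_rel_def)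
  next
    case False
    have fin: "finite (dom h)" and inj: "inj_on h (dom h)" using p hg by (auto simp: cond_def)
    have "finite (ran h)" using fin by (rule finite_ran)
    \<comment> \<open>The inverse of \<open>h\<close> recovers the column mapped to
      \<open>m\<close>; it is applied to \<open>Some m\<close> because \<open>h\<close> is a partial
      map.\<close>
    then obtain k where
      k: "\<forall>m\<in>ran h. U \<alpha> k m = f \<alpha> (the_inv_into (dom h) h (Some m))"
      using U[unfolded universal_seed_def, THEN conjunct2, rule_format, of "ran h" \<alpha>
          "\<lambda>m. f \<alpha> (the_inv_into (dom h) h (Some m))"] by blast
    have "U \<alpha> k m = f \<alpha> n" if "h n = Some m" for n m
    proof -
      have "the_inv_into (dom h) h (Some m) = n"
        using the_inv_into_f_f[OF inj, of n] that by auto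
      thus ?thesis using k that by (auto simp: ran_def)
    qed
    hence "(h, g(\<alpha> \<mapsto> k)) \<in> cond U f" using p hg by (auto simp: cond_def)
    moreover have "g \<subseteq>\<^sub>m g(\<alpha> \<mapsto> k)" using False by (auto simp: map_le_def)
    ultimately show ?thesis using p hg
      by (intro bexI[of _ "(h, g(\<alpha> \<mapsto> k))"]) (auto simp: cond_rel_def)
  qed
qed auto

text \<open>Lets the partial order be copied into any \<open>'p\<close> with at least
  \<open>omega1\<close> many elements.\<close>

lemma card_of_cond: "|cond U f| \<le>o |UNIV :: omega1 set|"
proof -
  have 1: "|{h :: nat \<rightharpoonup> nat. finite (dom h)}| \<le>o |UNIV :: omega1 set|"
    using card_of_finite_maps[where 'a = nat and 'b = nat]
      countable_ordLeq_omega1[of "UNIV :: nat set"] ordLeq_transitive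
    by (simp add: card_of_refl ordIso_imp_ordLeq) blast
  have 2: "|{g :: omega1 \<rightharpoonup> nat. finite (dom g)}| \<le>o |UNIV :: omega1 set|"
    by (intro card_of_finite_maps infinite_omega1 countable_ordLeq_omega1) simp
  have "|cond U f| \<le>o |{h :: nat \<rightharpoonup> nat. finite (dom h)} \<times> {g :: omega1 \<rightharpoonup> nat. finite (dom g)}|"
    by (rule card_of_mono1) (auto simp: cond_def)
  also have "|{h :: nat \<rightharpoonup> nat. finite (dom h)} \<times> {g :: omega1 \<rightharpoonup> nat. finite (dom g)}|
               \<le>o |UNIV :: omega1 set|"
    using 1 2 infinite_omega1
    by (intro card_of_Times_ordLeq_infinite_Field) (auto simp: card_of_card_order_on Field_card_of)
  finally show ?thesis .
qed

text \<open>A filter meeting the countably many column sets and the \<open>omega1\<close> many row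
  sets decides \<open>h\<close> at every \<open>n\<close> and \<open>k\<close> at every
  \<alpha>.\<close>

lemma MA_universal_seed:
  assumes "|UNIV :: omega1 set| \<le>o |UNIV :: 'p set|" and "MA_omega1 TYPE('p)"
    and U: "universal_seed U"
  shows "\<exists>(k :: omega1 \<Rightarrow> nat) (h :: nat \<Rightarrow> nat). \<forall>\<alpha> n. U \<alpha> (k \<alpha>) (h n) = f \<alpha> n"
proof -
  let ?P = "cond U f" and ?r = "cond_rel U f"
  define Dc where "Dc n = {p \<in> ?P. n \<in> dom (fst p)}" for n
  define Dr where "Dr \<alpha> = {p \<in> ?P. \<alpha> \<in> dom (snd p)}" for \<alpha>
  have "|range Dc \<union> range Dr| \<le>o |UNIV :: omega1 set|"
    using infinite_omega1 card_of_image[of Dr UNIV]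
    by (intro card_of_Un_ordLeq_infinite_Field)
      (auto simp: card_of_card_order_on Field_card_of intro!: countable_ordLeq_omega1)
  moreover have "dense_in ?P ?r D" if "D \<in> range Dc \<union> range Dr" for D
    using that dense_cond_column[OF U] dense_cond_row[OF U] by (auto simp: Dc_def Dr_def)
  moreover have "|?P| \<le>o |UNIV :: 'p set|"
    using card_of_cond assms(1) by (rule ordLeq_transitive)
  moreover have "(Map.empty, Map.empty) \<in> ?P" by (simp add: cond_def)
  ultimately obtain G where G: "filter_in ?P ?r G"
    and meet: "\<And>D. D \<in> range Dc \<union> range Dr \<Longrightarrow> G \<inter> D \<noteq> {}"
    using MA_omega1D[OF assms(2) _ _ partial_order_cond ccc_cond] by (metis empty_iff)
  have "\<exists>p\<in>G. n \<in> dom (fst p)" for n using meet[of "Dc n"] by (auto simp: Dc_def)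
  then obtain pc where pc: "\<And>n. pc n \<in> G" "\<And>n. n \<in> dom (fst (pc n))" by metis
  have "\<exists>p\<in>G. \<alpha> \<in> dom (snd p)" for \<alpha> using meet[of "Dr \<alpha>"] by (auto simp: Dr_def)
  then obtain pr where pr: "\<And>\<alpha>. pr \<alpha> \<in> G" "\<And>\<alpha>. \<alpha> \<in> dom (snd (pr \<alpha>))" by metis
  have "U \<alpha> (the (snd (pr \<alpha>) \<alpha>)) (the (fst (pc n) n)) = f \<alpha> n" for \<alpha> n
  proof -
    \<comment> \<open>Column \<open>n\<close> and row \<alpha> may be decided by different members
      of the filter; a common extension keeps both decisions and, being a condition, relates
      them.\<close>
    obtain s where s: "s \<in> ?P" "(s, pc n) \<in> ?r" "(s, pr \<alpha>) \<in> ?r"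
      using G pc(1) pr(1) unfolding filter_in_def by (meson subsetD)
    have "fst s n = fst (pc n) n" "snd s \<alpha> = snd (pr \<alpha>) \<alpha>"
      using s(2,3) pc(2)[of n] pr(2)[of \<alpha>]
      by (simp_all add: cond_rel_def map_le_def split: prod.splits)
    moreover have "\<exists>m. fst s n = Some m" "\<exists>k. snd s \<alpha> = Some k"
      using calculation pc(2)[of n] pr(2)[of \<alpha>] by auto
    ultimately show ?thesis using s(1) by (auto simp: cond_def)
  qed
  thus ?thesis
    by (intro exI[of _ "\<lambda>\<alpha>. the (snd (pr \<alpha>) \<alpha>)"] exI[of _ "\<lambda>n. the (fst (pc n) n)"]) blast
qed

section \<open>From natural-number values to values in \<open>omega1\<close>\<close>

theorem theorem5p7:
  assumes "|UNIV :: omega1 set| \<le>o |UNIV :: 'p set|"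
    and "MA_omega1 TYPE('p)"
  shows "\<exists>F :: omega1 \<times> nat \<Rightarrow> omega1.
           \<forall>f :: omega1 \<times> nat \<Rightarrow> omega1.
             \<exists>(g :: omega1 \<Rightarrow> omega1) (h :: nat \<Rightarrow> nat).
               \<forall>\<alpha> n. f (\<alpha>, n) = F (g \<alpha>, h n)"
proof -
  obtain U where U: "universal_seed U" using universal_seed_exists by blast
  obtain e :: "omega1 \<Rightarrow> nat \<Rightarrow> omega1"
    where e: "\<And>A. countable A \<Longrightarrow> \<exists>\<delta>. A \<subseteq> range (e \<delta>)"
    using omega1_enumerations by blast
  have "|(UNIV :: omega1 set) \<times> ((UNIV :: nat set) \<times> (UNIV :: omega1 set))| \<le>o |UNIV :: omega1 set|"
    using infinite_omega1
    by (intro card_of_Times_ordLeq_infinite_Field)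
      (auto simp: card_of_card_order_on card_of_refl ordIso_imp_ordLeq countable_ordLeq_omega1 Field_card_of
        simp del: UNIV_Times_UNIV)
  then obtain c :: "omega1 \<times> nat \<times> omega1 \<Rightarrow> omega1" where c: "inj c"
    using card_of_ordLeq[of "UNIV :: (omega1 \<times> nat \<times> omega1) set" "UNIV :: omega1 set"]
    by auto
  \<comment> \<open>A first argument codes a row \<alpha>, an alteration \<open>k\<close> and an
    enumeration index \<delta>. The seed yields a natural number, which \<open>e \<delta>\<close>
    turns into an element of \<open>omega1\<close>.\<close>
  define F where "F = (\<lambda>(\<beta>, m). case inv c \<beta> of (\<alpha>, k, \<delta>) \<Rightarrow> e \<delta> (U \<alpha> k m))"
  have "\<exists>g h. \<forall>\<alpha> n. f (\<alpha>, n) = F (g \<alpha>, h n)" for f :: "omega1 \<times> nat \<Rightarrow> omega1"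
  proof -
    \<comment> \<open>Only the index \<delta> depends on the countable range of the row; what
      remains is the function \<open>f'\<close> with values in \<open>nat\<close>, to which Martin's
      Axiom is applied.\<close>
    have "\<exists>\<delta>. range (\<lambda>n. f (\<alpha>, n)) \<subseteq> range (e \<delta>)" for \<alpha> by (rule e) simp
    then obtain \<delta> where "\<And>\<alpha>. range (\<lambda>n. f (\<alpha>, n)) \<subseteq> range (e (\<delta> \<alpha>))" by metis
    hence "\<exists>i. f (\<alpha>, n) = e (\<delta> \<alpha>) i" for \<alpha> n by blast
    then obtain f' where f': "\<And>\<alpha> n. f (\<alpha>, n) = e (\<delta> \<alpha>) (f' \<alpha> n)" by metis
    obtain k h where "\<And>\<alpha> n. U \<alpha> (k \<alpha>) (h n) = f' \<alpha> n"
      using MA_universal_seed[OF assms U, of f'] by blast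
    hence "f (\<alpha>, n) = F (c (\<alpha>, k \<alpha>, \<delta> \<alpha>), h n)" for \<alpha> n
      using c f' by (simp add: F_def)
    thus ?thesis by (intro exI[of _ "\<lambda>\<alpha>. c (\<alpha>, k \<alpha>, \<delta> \<alpha>)"] exI[of _ h]) blast
  qed
  thus ?thesis by blast
qed

end
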